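(* Let $n,N\ge 1$ be integers and let $\omega_1,\dots,\omega_N>0$. Let $f\colon\mathbb{R}^{nN}\to\mathbb{R}$ be defined, for every $\boldsymbol{x}=(x_1,\dots,x_N)$ with $x_i\in\mathbb{R}^n$, by $$f(\boldsymbol{x})=\max_{1\le i\le N}\omega_i\|x_i\|^2 .$$ Let $\boldsymbol{x}\in\mathbb{R}^{nN}$ and $\lambda>0$. For every $i\in\{1,\dots,N\}$ put $\lambda_i=\lambda\omega_i$ and $\alpha_i=\omega_i\|x_i\|^2$. Then $$\operatorname{prox}_{\lambda f}(\boldsymbol{x})=\left(\frac{x_i}{1+2\lambda_i\overline{p}_i}\right)_{i=1}^{N},$$ where $\overline{p}\in\mathbb{R}^N$ is a solution to $$\max_{p\in\Delta_N}\ \sum_{i=1}^{N}\frac{\alpha_i p_i}{1+2\lambda_i p_i}.$$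
   Context: $\|\cdot\|$ is the Euclidean norm. $\Delta_N=\{p\in\mathbb{R}^N : p_i\ge 0 \text{ for all } i,\ \sum_{i=1}^N p_i=1\}$ is the probability simplex. For a convex, lower semicontinuous, proper function $f\colon\mathbb{R}^m\to\mathbb{R}\cup\{+\infty\}$ and $\lambda>0$, $\operatorname{prox}_{\lambda f}(x)$ denotes the unique minimizer over $y\in\mathbb{R}^m$ of $f(y)+\frac{1}{2\lambda}\|y-x\|^2$. *)

theory Defs
  imports "HOL-Analysis.Analysis"
begin

(* Functions into the extended half-line are ereal-valued, so that prox makes sense for every
   proper convex lower semicontinuous f; it denotes the unique minimizer whenever there is one. *)
definition prox :: "real \<Rightarrow> ('a::euclidean_space \<Rightarrow> ereal) \<Rightarrow> 'a \<Rightarrow> 'a" where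
  "prox lam f x =
     (THE y. is_arg_min (\<lambda>y. f y + ereal (1 / (2 * lam) * (norm (y - x))\<^sup>2)) (\<lambda>_. True) y)"

definition prob_simplex :: "(real ^ 'N) set" where
  "prob_simplex = {p. (\<forall>i. 0 \<le> p $ i) \<and> (\<Sum>i\<in>UNIV. p $ i) = 1}"

(* A point of R^(nN) is a block vector x with blocks x $ i in R^n; the norm of the nested vector
   type is the Euclidean norm of R^(nN). *)
definition max_wsq :: "real ^ 'N \<Rightarrow> (real ^ 'n) ^ 'N \<Rightarrow> real" where
  "max_wsq \<omega> x = (MAX i. \<omega> $ i * (norm (x $ i))\<^sup>2)"

lemma convex_on_max_wsq:
  fixes \<omega> :: "real ^ 'N"
  assumes "\<And>i. \<omega> $ i > 0"
  shows "convex_on UNIV (max_wsq \<omega> :: (real ^ 'n) ^ 'N \<Rightarrow> real)"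
proof (rule convex_onI)
  fix t :: real and x y :: "(real ^ 'n) ^ 'N"
  assume t: "0 < t" "t < 1"
  have le: "\<omega> $ i * (norm (z $ i))\<^sup>2 \<le> max_wsq \<omega> z" for i and z :: "(real ^ 'n) ^ 'N"
    unfolding max_wsq_def by (rule Max_ge) auto
  have "\<omega> $ i * (norm (((1 - t) *\<^sub>R x + t *\<^sub>R y) $ i))\<^sup>2
          \<le> (1 - t) * max_wsq \<omega> x + t * max_wsq \<omega> y" for i
  proof -
    have "(norm (((1 - t) *\<^sub>R x + t *\<^sub>R y) $ i))\<^sup>2
            \<le> ((1 - t) * norm (x $ i) + t * norm (y $ i))\<^sup>2"
      using t norm_triangle_ineq[of "(1 - t) *\<^sub>R x $ i" "t *\<^sub>R y $ i"]
      by (intro power_mono) auto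
    also have "\<dots> \<le> (1 - t) * (norm (x $ i))\<^sup>2 + t * (norm (y $ i))\<^sup>2"
    proof -
      have "(1 - t) * (norm (x $ i))\<^sup>2 + t * (norm (y $ i))\<^sup>2
              - ((1 - t) * norm (x $ i) + t * norm (y $ i))\<^sup>2
            = (1 - t) * t * (norm (x $ i) - norm (y $ i))\<^sup>2"
        by (simp add: power2_eq_square algebra_simps)
      moreover have "\<dots> \<ge> 0" using t by simp
      ultimately show ?thesis by linarith
    qed
    finally have "\<omega> $ i * (norm (((1 - t) *\<^sub>R x + t *\<^sub>R y) $ i))\<^sup>2
        \<le> \<omega> $ i * ((1 - t) * (norm (x $ i))\<^sup>2 + t * (norm (y $ i))\<^sup>2)"
      using assms[of i] by simp
    also have "\<dots> = (1 - t) * (\<omega> $ i * (norm (x $ i))\<^sup>2) + t * (\<omega> $ i * (norm (y $ i))\<^sup>2)"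
      by (simp add: algebra_simps)
    also have "\<dots> \<le> (1 - t) * max_wsq \<omega> x + t * max_wsq \<omega> y"
      using t le by (intro add_mono mult_left_mono) auto
    finally show ?thesis .
  qed
  then show "max_wsq \<omega> ((1 - t) *\<^sub>R x + t *\<^sub>R y) \<le> (1 - t) * max_wsq \<omega> x + t * max_wsq \<omega> y"
    unfolding max_wsq_def[of \<omega> "(1 - t) *\<^sub>R x + t *\<^sub>R y"] by (subst Max_le_iff) auto
qed auto

lemma prox_well_defined:
  fixes g :: "'a::euclidean_space \<Rightarrow> real"
  assumes g: "convex_on UNIV g" and c: "\<And>y. c \<le> g y" and lam: "lam > 0"
  shows "\<exists>!y. is_arg_min (\<lambda>y. ereal (g y) + ereal (1 / (2 * lam) * (norm (y - x))\<^sup>2)) (\<lambda>_. True) y"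
proof -
  define F where "F y = g y + 1 / (2 * lam) * (norm (y - x))\<^sup>2" for y
  have iff: "is_arg_min (\<lambda>y. ereal (g y) + ereal (1 / (2 * lam) * (norm (y - x))\<^sup>2)) (\<lambda>_. True) y
      \<longleftrightarrow> (\<forall>z. F y \<le> F z)" for y
    by (auto simp: is_arg_min_linorder F_def)
  have "continuous_on UNIV g"
    using g by (intro convex_on_continuous) auto
  then have cont: "continuous_on S F" for S
    unfolding F_def by (intro continuous_intros) (auto intro: continuous_on_subset)
  define R where "R = sqrt (2 * lam * (g x - c))"
  have R: "R \<ge> 0" "R\<^sup>2 = 2 * lam * (g x - c)"
    using lam c[of x] by (auto simp: R_def)
  obtain y where y: "y \<in> cball x R" "\<And>z. z \<in> cball x R \<Longrightarrow> F y \<le> F z"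
    using continuous_attains_inf[OF compact_cball _ cont, of x R] R by auto
  have ex: "F y \<le> F z" for z
  proof (cases "z \<in> cball x R")
    case False
    then have "R < norm (z - x)"
      by (simp add: dist_norm norm_minus_commute)
    then have "R\<^sup>2 < (norm (z - x))\<^sup>2"
      using R(1) by (intro power_strict_mono) auto
    then have "g x - c < 1 / (2 * lam) * (norm (z - x))\<^sup>2"
      using lam R(2) by (simp add: field_simps)
    then have "F x \<le> F z"
      using c[of z] by (simp add: F_def)
    moreover have "F y \<le> F x" using y(2)[of x] R(1) by simp
    ultimately show ?thesis by simp
  qed (rule y)
  have un: "y = z" if "\<forall>w. F y \<le> F w" "\<forall>w. F z \<le> F w" for y z
  proof (rule ccontr)
    assume "y \<noteq> z"
    define m where "m = (1 - 1/2) *\<^sub>R y + (1/2) *\<^sub>R z"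
    have "g m \<le> (1 - 1/2) * g y + (1/2) * g z"
      unfolding m_def by (rule convex_onD[OF g]) auto
    moreover have nm: "(norm (m - x))\<^sup>2
        = ((norm (y - x))\<^sup>2 + (norm (z - x))\<^sup>2) / 2 - (norm (y - z))\<^sup>2 / 4"
    proof -
      have "m - x = (1/2) *\<^sub>R ((y - x) + (z - x))"
      proof -
        have "x = (1/2) *\<^sub>R x + (1/2) *\<^sub>R x" by (simp flip: scaleR_add_left)
        then have "- x = - ((1/2) *\<^sub>R x) - (1/2) *\<^sub>R x"
          by (metis ab_group_add_class.ab_diff_conv_add_uminus minus_add_distrib)
        then show ?thesis
          by (simp add: m_def scaleR_right_diff_distrib scaleR_right_distrib)
      qed
      then have "(norm (m - x))\<^sup>2 = (norm ((y - x) + (z - x)))\<^sup>2 / 4"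
        by (simp add: power_divide)
      moreover have "(norm (u + v))\<^sup>2 + (norm (u - v))\<^sup>2 = 2 * (norm u)\<^sup>2 + 2 * (norm v)\<^sup>2"
        for u v :: 'a
        by (simp add: power2_norm_eq_inner inner_add_left inner_add_right
            inner_diff_left inner_diff_right)
      from this[of "y - x" "z - x"]
      have "(norm ((y - x) + (z - x)))\<^sup>2
          = 2 * (norm (y - x))\<^sup>2 + 2 * (norm (z - x))\<^sup>2 - (norm (y - z))\<^sup>2" by simp
      ultimately show ?thesis by argo
    qed
    have "1 / (2 * lam) * (norm (m - x))\<^sup>2
        = (1 / (2 * lam) * (norm (y - x))\<^sup>2 + 1 / (2 * lam) * (norm (z - x))\<^sup>2) / 2
          - 1 / (2 * lam) * (norm (y - z))\<^sup>2 / 4"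
      by (simp only: nm) (simp add: algebra_simps diff_divide_distrib add_divide_distrib)
    moreover have "1 / (2 * lam) * (norm (y - z))\<^sup>2 > 0"
      using lam \<open>y \<noteq> z\<close> by simp
    ultimately have "F m < (F y + F z) / 2"
      unfolding F_def by argo
    then show False using that(1)[rule_format, of m] that(2)[rule_format, of m] by simp
  qed
  show ?thesis unfolding iff using ex un by blast
qed

end

theory Submission
  imports Defs
begin

text \<open>
  Let \<open>p\<close> solve the maximization problem, \<open>y\<^sub>i = x\<^sub>i / (1 + 2 \<lambda>\<^sub>i p\<^sub>i)\<close> and
  \<open>M = \<Sum>i. p\<^sub>i \<omega>\<^sub>i \<parallel>y\<^sub>i\<parallel>\<^sup>2\<close>. The \<open>i\<close>-th partial derivative of the objective at \<open>p\<close> is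
  \<open>\<omega>\<^sub>i \<parallel>y\<^sub>i\<parallel>\<^sup>2\<close>, so first-order optimality in the direction of the \<open>j\<close>-th vertex of the
  simplex reads \<open>\<omega>\<^sub>j \<parallel>y\<^sub>j\<parallel>\<^sup>2 \<le> M\<close>; hence \<open>f y = M\<close>. Bounding the maximum below by the average
  with weights \<open>p\<close> replaces the prox objective by a separable quadratic which is minimized
  at \<open>y\<close> and agrees with the prox objective there.
\<close>

lemma power2_norm_vec:
  fixes z :: "'a::real_normed_vector ^ 'N"
  shows "(norm z)\<^sup>2 = (\<Sum>i\<in>UNIV. (norm (z $ i))\<^sup>2)"
  by (simp add: norm_vec_def L2_set_def sum_nonneg)

lemma max_wsq_ge: "\<omega> $ i * (norm (z $ i))\<^sup>2 \<le> max_wsq \<omega> z"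
  unfolding max_wsq_def by (rule Max_ge) auto

lemma compact_prob_simplex: "compact (prob_simplex :: (real ^ 'N) set)"
proof -
  have "norm p \<le> 1" if "p \<in> prob_simplex" for p :: "real ^ 'N"
    using norm_le_l1_cart[of p] that by (simp add: prob_simplex_def)
  then have "bounded (prob_simplex :: (real ^ 'N) set)"
    by (auto simp: bounded_iff)
  moreover have "closed (prob_simplex :: (real ^ 'N) set)"
    unfolding prob_simplex_def
    by (intro closed_Collect_conj closed_Collect_all closed_Collect_le closed_Collect_eq
        continuous_intros)
  ultimately show ?thesis by (simp add: compact_eq_bounded_closed)
qed

lemma axis_mem_prob_simplex: "axis j 1 \<in> prob_simplex"
  by (auto simp: prob_simplex_def axis_def)

lemma convex_prob_simplex: "convex (prob_simplex :: (real ^ 'N) set)"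
  by (rule convexI) (auto simp: prob_simplex_def sum.distrib simp flip: sum_distrib_left)

text \<open>A positive derivative would push \<open>\<phi>\<close> above \<open>\<phi> 0\<close>
  just to the right of 0. Only positive \<open>t\<close> are compared, because a maximizer on the
  boundary of the simplex need not allow a step backwards.\<close>

lemma deriv_along_segment_nonpos_of_max:
  fixes \<phi> :: "real \<Rightarrow> real"
  assumes "(\<phi> has_real_derivative D) (at 0)" and "\<And>t. 0 < t \<Longrightarrow> t < 1 \<Longrightarrow> \<phi> t \<le> \<phi> 0"
  shows "D \<le> 0"
proof (rule ccontr)
  assume "\<not> D \<le> 0"
  then obtain d where d: "d > 0" "\<And>h. 0 < h \<Longrightarrow> h < d \<Longrightarrow> \<phi> 0 < \<phi> (0 + h)"
    using DERIV_pos_inc_right[OF assms(1)] by auto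
  define h where "h = min (d / 2) (1 / 2)"
  have "0 < h" "h < d" "h < 1" using d(1) by (auto simp: h_def)
  then show False using d(2)[of h] assms(2)[of h] by simp
qed

text \<open>Moving from \<open>p\<close> straight towards the vertex \<open>axis j 1\<close> stays
  in the simplex, and the slope of the objective at the start is the \<open>j\<close>-th partial
  derivative minus the \<open>p\<close>-average of all of them.\<close>

lemma first_order_prob_simplex:
  fixes a l p :: "real ^ 'N"
  assumes l: "\<And>i. l $ i > 0"
    and max: "is_arg_max (\<lambda>p. \<Sum>i\<in>UNIV. a $ i * p $ i / (1 + 2 * l $ i * p $ i))
                (\<lambda>p. p \<in> prob_simplex) p"
  shows "a $ j / (1 + 2 * l $ j * p $ j)\<^sup>2
           \<le> (\<Sum>i\<in>UNIV. p $ i * (a $ i / (1 + 2 * l $ i * p $ i)\<^sup>2))"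
proof -
  define G where "G p = (\<Sum>i\<in>UNIV. a $ i * p $ i / (1 + 2 * l $ i * p $ i))" for p :: "real ^ 'N"
  define g where "g i = a $ i / (1 + 2 * l $ i * p $ i)\<^sup>2" for i
  define v where "v = axis j 1 - p"
  have p: "p \<in> prob_simplex" and le: "\<And>q. q \<in> prob_simplex \<Longrightarrow> G q \<le> G p"
    using max by (auto simp: is_arg_max_linorder G_def)
  have pos: "1 + 2 * l $ i * p $ i > 0" for i
    using p l[of i] by (auto simp: prob_simplex_def intro!: add_pos_nonneg)
  have "((\<lambda>t. a $ i * (p $ i + t * v $ i) / (1 + 2 * l $ i * (p $ i + t * v $ i)))
          has_real_derivative g i * v $ i) (at 0)" for i
    using pos[of i]
    by (auto intro!: derivative_eq_intros simp: g_def power2_eq_square divide_simps)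
       (simp add: algebra_simps)
  then have "((\<lambda>t. G (p + t *\<^sub>R v)) has_real_derivative (\<Sum>i\<in>UNIV. g i * v $ i)) (at 0)"
    unfolding G_def by (auto intro!: DERIV_sum)
  moreover have "G (p + t *\<^sub>R v) \<le> G (p + 0 *\<^sub>R v)" if "0 < t" "t < 1" for t
  proof -
    have "p + t *\<^sub>R v = (1 - t) *\<^sub>R p + t *\<^sub>R axis j 1"
      by (simp add: v_def algebra_simps)
    then have "p + t *\<^sub>R v \<in> prob_simplex"
      using convexD_alt[OF convex_prob_simplex p axis_mem_prob_simplex[of j], of t] that by simp
    then show ?thesis using le by simp
  qed
  ultimately have "(\<Sum>i\<in>UNIV. g i * v $ i) \<le> 0"
    by (rule deriv_along_segment_nonpos_of_max)
  moreover have "(\<Sum>i\<in>UNIV. g i * axis j 1 $ i) = g j"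
    by (simp add: axis_def if_distrib cong: if_cong)
  ultimately have "g j \<le> (\<Sum>i\<in>UNIV. p $ i * g i)"
    by (simp add: v_def right_diff_distrib sum_subtractf mult.commute)
  then show ?thesis by (simp only: g_def)
qed

text \<open>The hypothesis says that \<open>y\<close> is the critical point of the quadratic in
  \<open>z\<close> on the left, so expanding around \<open>y\<close> leaves no linear term.\<close>

lemma quadratic_completion:
  fixes y z :: "'a::real_inner"
  assumes "x = (1 + c) *\<^sub>R y"
  shows "c * (norm z)\<^sup>2 + (norm (z - x))\<^sup>2
           = c * (norm y)\<^sup>2 + (norm (y - x))\<^sup>2 + (1 + c) * (norm (z - y))\<^sup>2"
  by (simp add: assms power2_norm_eq_inner inner_add_left inner_add_right inner_diff_left
      inner_diff_right inner_commute)
     (simp add: algebra_simps)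

text \<open>The sufficiency half of the argument: no maximality of \<open>p\<close> is assumed, only
  that no block of \<open>y\<close> exceeds the \<open>p\<close>-average.\<close>

lemma prox_max_wsq_eq:
  fixes \<omega> :: "real ^ 'N" and x y :: "(real ^ 'n) ^ 'N"
  assumes \<omega>: "\<And>i. \<omega> $ i > 0" and lam: "lam > 0" and p: "p \<in> prob_simplex"
    and xy: "\<And>i. x $ i = (1 + 2 * (lam * \<omega> $ i) * p $ i) *\<^sub>R y $ i"
    and y: "\<And>j. \<omega> $ j * (norm (y $ j))\<^sup>2 \<le> (\<Sum>i\<in>UNIV. p $ i * (\<omega> $ i * (norm (y $ i))\<^sup>2))"
  shows "prox lam (\<lambda>y. ereal (max_wsq \<omega> y)) x = y"
proof -
  have p0: "p $ i \<ge> 0" and p1: "(\<Sum>i\<in>UNIV. p $ i) = 1" for i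
    using p by (auto simp: prob_simplex_def)
  define S where "S z = (\<Sum>i\<in>UNIV. p $ i * (\<omega> $ i * (norm (z $ i))\<^sup>2))" for z :: "(real ^ 'n) ^ 'N"
  have S_le: "S z \<le> max_wsq \<omega> z" for z
  proof -
    have "S z \<le> (\<Sum>i\<in>UNIV. p $ i * max_wsq \<omega> z)"
      unfolding S_def by (intro sum_mono mult_left_mono max_wsq_ge p0)
    then show ?thesis by (simp add: p1 flip: sum_distrib_right)
  qed
  have le_S: "max_wsq \<omega> y \<le> S y"
    unfolding max_wsq_def S_def using y by (subst Max_le_iff) auto
  \<comment> \<open>Scaling by \<open>2 * lam\<close> puts each block in the form of
    \<open>quadratic_completion\<close> with
    \<open>c = 2 * (lam * \<omega> $ i) * p $ i\<close>.\<close>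
  have sep: "2 * lam * S z + (norm (z - x))\<^sup>2
      = (\<Sum>i\<in>UNIV. 2 * (lam * \<omega> $ i) * p $ i * (norm (z $ i))\<^sup>2 + (norm (z $ i - x $ i))\<^sup>2)" for z
    by (simp add: S_def power2_norm_vec sum.distrib sum_distrib_left mult_ac)
  have "2 * lam * S y + (norm (y - x))\<^sup>2 \<le> 2 * lam * S z + (norm (z - x))\<^sup>2" for z
    unfolding sep
  proof (rule sum_mono)
    fix i
    have "0 \<le> (1 + 2 * (lam * \<omega> $ i) * p $ i) * (norm (z $ i - y $ i))\<^sup>2"
      using lam \<omega>[of i] p0[of i] by simp
    then show "2 * (lam * \<omega> $ i) * p $ i * (norm (y $ i))\<^sup>2 + (norm (y $ i - x $ i))\<^sup>2
        \<le> 2 * (lam * \<omega> $ i) * p $ i * (norm (z $ i))\<^sup>2 + (norm (z $ i - x $ i))\<^sup>2"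
      using quadratic_completion[OF xy[of i], of "z $ i"] by linarith
  qed
  then have "(2 * lam * S y + (norm (y - x))\<^sup>2) / (2 * lam)
      \<le> (2 * lam * S z + (norm (z - x))\<^sup>2) / (2 * lam)" for z
    using lam by (intro divide_right_mono) auto
  then have "S y + 1 / (2 * lam) * (norm (y - x))\<^sup>2 \<le> S z + 1 / (2 * lam) * (norm (z - x))\<^sup>2" for z
    using lam by (simp add: add_divide_distrib)
  then have "max_wsq \<omega> y + 1 / (2 * lam) * (norm (y - x))\<^sup>2
      \<le> max_wsq \<omega> z + 1 / (2 * lam) * (norm (z - x))\<^sup>2" for z
    using le_S S_le[of z] by (smt (verit))
  then have "is_arg_min (\<lambda>y. ereal (max_wsq \<omega> y) + ereal (1 / (2 * lam) * (norm (y - x))\<^sup>2))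
      (\<lambda>_. True) y"
    by (auto simp: is_arg_min_linorder)
  \<comment> \<open>The lower bound required by \<open>prox_well_defined\<close>;
    \<open>undefined\<close> is just some index, as any single term bounds the maximum
    below.\<close>
  moreover have "0 \<le> max_wsq \<omega> z" for z :: "(real ^ 'n) ^ 'N"
    using max_wsq_ge[of \<omega> undefined z] \<omega>[of undefined]
    by (meson mult_nonneg_nonneg less_imp_le order_trans zero_le_power2)
  ultimately show ?thesis
    unfolding prox_def
    by (intro the1_equality prox_well_defined[OF convex_on_max_wsq[OF \<omega>] _ lam])
qed

theorem proposition2p1:
  fixes \<omega> \<alpha> lami :: "real ^ 'N" and x :: "(real ^ 'n) ^ 'N" and lam :: real
  assumes "\<And>i. \<omega> $ i > 0" and "lam > 0"
    and "\<And>i. lami $ i = lam * \<omega> $ i"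
    and "\<And>i. \<alpha> $ i = \<omega> $ i * (norm (x $ i))\<^sup>2"
  shows "(\<exists>p. is_arg_max (\<lambda>p. \<Sum>i\<in>UNIV. \<alpha> $ i * p $ i / (1 + 2 * lami $ i * p $ i))
                (\<lambda>p. p \<in> prob_simplex) p) \<and>
         (\<forall>p. is_arg_max (\<lambda>p. \<Sum>i\<in>UNIV. \<alpha> $ i * p $ i / (1 + 2 * lami $ i * p $ i))
                (\<lambda>p. p \<in> prob_simplex) p \<longrightarrow>
              prox lam (\<lambda>y. ereal (max_wsq \<omega> y)) x
                = (\<chi> i. (1 / (1 + 2 * lami $ i * p $ i)) *\<^sub>R x $ i))"
proof (intro conjI allI impI)
  have lami: "lami $ i > 0" for i using assms(1-3) by simp
  have pos: "1 + 2 * lami $ i * p $ i > 0" if "p \<in> prob_simplex" for p i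
    using that lami[of i] by (auto simp: prob_simplex_def intro!: add_pos_nonneg)
  define G where "G p = (\<Sum>i\<in>UNIV. \<alpha> $ i * p $ i / (1 + 2 * lami $ i * p $ i))" for p :: "real ^ 'N"
  \<comment> \<open>Existence comes from compactness: the denominators stay positive on the
    simplex.\<close>
  have "continuous_on prob_simplex G"
    unfolding G_def using pos by (intro continuous_intros) (auto simp: less_imp_neq[symmetric])
  moreover have "(prob_simplex :: (real ^ 'N) set) \<noteq> {}"
    using axis_mem_prob_simplex by blast
  ultimately obtain p where "p \<in> prob_simplex" "\<And>q. q \<in> prob_simplex \<Longrightarrow> G q \<le> G p"
    using continuous_attains_sup[OF compact_prob_simplex] by metis
  then show "\<exists>p. is_arg_max (\<lambda>p. \<Sum>i\<in>UNIV. \<alpha> $ i * p $ i / (1 + 2 * lami $ i * p $ i))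
      (\<lambda>p. p \<in> prob_simplex) p"
    by (auto simp: is_arg_max_linorder G_def)
  fix p
  assume max: "is_arg_max (\<lambda>p. \<Sum>i\<in>UNIV. \<alpha> $ i * p $ i / (1 + 2 * lami $ i * p $ i))
      (\<lambda>p. p \<in> prob_simplex) p"
  then have p: "p \<in> prob_simplex" by (simp add: is_arg_max_def)
  define y where "y = (\<chi> i. (1 / (1 + 2 * lami $ i * p $ i)) *\<^sub>R x $ i)"
  \<comment> \<open>This identity turns the first-order condition on \<open>p\<close> into the block
    condition on \<open>y\<close>.\<close>
  have grad: "\<alpha> $ i / (1 + 2 * lami $ i * p $ i)\<^sup>2 = \<omega> $ i * (norm (y $ i))\<^sup>2" for i
    by (simp add: y_def assms(4) power_divide)
  have "prox lam (\<lambda>y. ereal (max_wsq \<omega> y)) x = y"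
  proof (rule prox_max_wsq_eq[OF assms(1,2) p])
    show "x $ i = (1 + 2 * (lam * \<omega> $ i) * p $ i) *\<^sub>R y $ i" for i
      using pos[OF p, of i] by (simp add: y_def assms(3))
    show "\<omega> $ j * (norm (y $ j))\<^sup>2 \<le> (\<Sum>i\<in>UNIV. p $ i * (\<omega> $ i * (norm (y $ i))\<^sup>2))" for j
      using first_order_prob_simplex[OF lami max, of j] by (simp only: grad)
  qed
  then show "prox lam (\<lambda>y. ereal (max_wsq \<omega> y)) x
      = (\<chi> i. (1 / (1 + 2 * lami $ i * p $ i)) *\<^sub>R x $ i)"
    by (simp add: y_def)
qed

end
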